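(* Let $L=K_1\cup\dots\cup K_\mu$ be an (oriented, virtual) link. The $\Lambda$-submodule of $M_A^{\mathrm{red}}(L)$ generated by the longitudes $\chi_1(L),\dots,\chi_\mu(L)$ is $$\mathrm{ann}(1-t)=\{x\in M_A^{\mathrm{red}}(L)\mid (1-t)x=0\}.$$
   Context: **Link diagrams.** A link diagram $D$ is an oriented virtual link diagram in $\mathbb R^2$: finitely many oriented, piecewise smooth closed curves $C_1,\dots,C_\mu$ with finitely many (self-)intersections, all transverse double points, each designated classical (with over/under information) or virtual. At each classical crossing the underpassing strand (only) is cut; nothing is cut at virtual crossings. The resulting pieces are the arcs; $A(D)$ is the set of arcs and $C(D)$ the set of classical crossings. $\kappa_D:A(D)\to\{1,\dots,\mu\}$ sends an arc to the index of the component containing it. Two diagrams are equivalent if related by a finite sequence of classical Reidemeister moves (involving only classical crossings) and detour moves (a segment of a curve $C_i$ with no classical crossing is replaced by any other piecewise smooth segment with the same endpoints and no classical crossing). A link $L=K_1\cup\dots\cup K_\mu$ is an equivalence class of diagrams, the component $K_i$ being represented by $C_i$. **Crossing data.** For $c\in C(D)$: $a(c)$ is the overpassing arc, $b_1(c)$ the underpassing arc on the right-hand side of the oriented arc $a(c)$, and $b_2(c)$ the underpassing arc on its left-hand side. The writhe $w(c)$ is $+1$ if the underpassing strand is oriented from $b_1(c)$ to $b_2(c)$, and $-1$ if it is oriented from $b_2(c)$ to $b_1(c)$. **Reduced Alexander module.** $\Lambda=\mathbb Z[t,t^{-1}]$. $\Lambda^{A(D)},\Lambda^{C(D)}$ are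 the free $\Lambda$-modules on $A(D),C(D)$. $\varrho_D:\Lambda^{C(D)}\to\Lambda^{A(D)}$ is the $\Lambda$-linear map with $\varrho_D(c)=(1-t)a(c)+tb_1(c)-b_2(c)$. $M_A^{\mathrm{red}}(D)=\operatorname{coker}\varrho_D$, with quotient map $\varsigma_D:\Lambda^{A(D)}\to M_A^{\mathrm{red}}(D)$. **Longitudes.** For $1\le i\le\mu$ the longitude of $K_i$ is $$\chi_i(D)=\varsigma_D\Big(\sum_{c\in C(D),\,\kappa_D(b_1(c))=i}w(c)a(c)-\tfrac12\sum_{c\in C(D),\,\kappa_D(b_1(c))=i}w(c)(b_1(c)+b_2(c))\Big),$$ where the second sum has all coefficients in $\{-2,0,2\}$ (each arc occurs $0$ or $2$ times as an underpassing arc), so multiplication by $\frac12$ makes sense. Up to isomorphism $(M_A^{\mathrm{red}}(D),\chi_1(D),\dots,\chi_\mu(D))$ depends only on the link $L$ represented by $D$; $M_A^{\mathrm{red}}(L)$ and $\chi_i(L)$ mean $M_A^{\mathrm{red}}(D)$ and $\chi_i(D)$ for any diagram $D$ of $L$. *)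

theory Defs
  imports
    "HOL-Analysis.Analysis"
    "HOL-Library.Poly_Mapping"
    "HOL-Algebra.Module"
    "HOL-Algebra.AbelCoset"
begin

section \<open>Oriented virtual link diagrams\<close>

text \<open>
  A closed curve in the plane is a map \<open>\<real> \<Rightarrow> \<complex>\<close> of period 1, oriented by increasing parameter;
  the plane \<open>\<real>\<^sup>2\<close> is \<open>\<complex>\<close> with its usual orientation.  Smoothness on a compact interval is
  existence of all derivatives, one-sided ones at the end points.
\<close>

definition smooth_on_interval :: "(real \<Rightarrow> complex) \<Rightarrow> real \<Rightarrow> real \<Rightarrow> bool" where
  "smooth_on_interval g a b \<longleftrightarrow>
     (\<exists>G :: nat \<Rightarrow> real \<Rightarrow> complex. (\<forall>s\<in>{a..b}. G 0 s = g s) \<and>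
        (\<forall>n. \<forall>s\<in>{a..b}. (G n has_vector_derivative G (Suc n) s) (at s within {a..b})))"

definition piecewise_smooth_closed_curve :: "(real \<Rightarrow> complex) \<Rightarrow> bool" where
  "piecewise_smooth_closed_curve g \<longleftrightarrow>
     (\<forall>s. g (s + 1) = g s) \<and>
     (\<exists>S. finite S \<and> {0, 1} \<subseteq> S \<and> S \<subseteq> {0..1} \<and>
        (\<forall>a\<in>S. \<forall>b\<in>S. a < b \<and> {a<..<b} \<inter> S = {} \<longrightarrow> smooth_on_interval g a b))"

text \<open>
  A point of one of the curves is recorded as a pair of a component index and a parameter
  in \<open>[0,1)\<close>.  Crossings are points of the plane; \<open>over_pt\<close> selects, at a classical crossing,
  the one of the two passages through it that is on top.  Its values elsewhere are irrelevant.
\<close>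

record diagram =
  ncomp :: nat
  curve :: "nat \<Rightarrow> real \<Rightarrow> complex"
  crossings :: "complex set"
  over_pt :: "complex \<Rightarrow> nat \<times> real"

definition params :: "diagram \<Rightarrow> (nat \<times> real) set" where
  "params D = {1..ncomp D} \<times> {0..<1}"

definition pos :: "diagram \<Rightarrow> nat \<times> real \<Rightarrow> complex" where
  "pos D p = curve D (fst p) (snd p)"

definition passages :: "diagram \<Rightarrow> complex \<Rightarrow> (nat \<times> real) set" where
  "passages D z = {p \<in> params D. pos D p = z}"

definition intersection_points :: "diagram \<Rightarrow> complex set" where
  "intersection_points D = {z. \<exists>p\<in>passages D z. \<exists>q\<in>passages D z. p \<noteq> q}"

definition tangent :: "diagram \<Rightarrow> nat \<times> real \<Rightarrow> complex" where
  "tangent D p = vector_derivative (curve D (fst p)) (at (snd p))"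

text \<open>The determinant of the pair \<open>(u, v)\<close> of plane vectors: positive iff \<open>v\<close> points to the left of \<open>u\<close>.\<close>

definition plane_det :: "complex \<Rightarrow> complex \<Rightarrow> real" where
  "plane_det u v = Re u * Im v - Im u * Re v"

definition transverse :: "diagram \<Rightarrow> nat \<times> real \<Rightarrow> nat \<times> real \<Rightarrow> bool" where
  "transverse D p q \<longleftrightarrow>
     curve D (fst p) differentiable at (snd p) \<and> curve D (fst q) differentiable at (snd q) \<and>
     plane_det (tangent D p) (tangent D q) \<noteq> 0"

text \<open>The virtual crossings are the intersection points that do not belong to \<open>crossings\<close>.\<close>

definition link_diagram :: "diagram \<Rightarrow> bool" where
  "link_diagram D \<longleftrightarrow>
     (\<forall>i\<in>{1..ncomp D}. piecewise_smooth_closed_curve (curve D i)) \<and>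
     finite (intersection_points D) \<and>
     (\<forall>z\<in>intersection_points D. \<exists>p q. p \<noteq> q \<and> passages D z = {p, q} \<and> transverse D p q) \<and>
     crossings D \<subseteq> intersection_points D \<and>
     (\<forall>c\<in>crossings D. over_pt D c \<in> passages D c)"

definition under_pt :: "diagram \<Rightarrow> complex \<Rightarrow> nat \<times> real" where
  "under_pt D c = (THE p. p \<in> passages D c \<and> p \<noteq> over_pt D c)"


section \<open>Arcs\<close>

text \<open>All real parameters, in every period, at which the \<open>i\<close>-th curve is cut.\<close>

definition cuts :: "diagram \<Rightarrow> nat \<Rightarrow> real set" where
  "cuts D i = {s. \<exists>c\<in>crossings D. under_pt D c = (i, frac s)}"

text \<open>
  An arc is a connected component of the circle \<open>\<real>/\<int>\<close> (the domain of the \<open>i\<close>-th curve) minus the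
  cut points, tagged with \<open>i\<close>; it is represented by its full preimage in \<open>\<real>\<close>.
\<close>

type_synonym arc = "nat \<times> real set"

definition arc_at :: "diagram \<Rightarrow> nat \<times> real \<Rightarrow> arc" where
  "arc_at D p =
     (fst p, {s. \<exists>n::int. connected_component (- cuts D (fst p)) (snd p) (s + of_int n)})"

definition arcs :: "diagram \<Rightarrow> arc set" where
  "arcs D = {arc_at D (i, s) | i s. i \<in> {1..ncomp D} \<and> s \<notin> cuts D i}"

definition component_of :: "arc \<Rightarrow> nat" where
  "component_of = fst"


section \<open>Crossing data\<close>

definition over_arc :: "diagram \<Rightarrow> complex \<Rightarrow> arc" where
  "over_arc D c = arc_at D (over_pt D c)"

text \<open>The underpassing arcs that end, respectively begin, at a crossing.\<close>

definition in_arc :: "diagram \<Rightarrow> complex \<Rightarrow> arc" where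
  "in_arc D c = (THE a. a \<in> arcs D \<and> component_of a = fst (under_pt D c) \<and>
     (\<forall>\<^sub>F s in at_left (snd (under_pt D c)). s \<in> snd a))"

definition out_arc :: "diagram \<Rightarrow> complex \<Rightarrow> arc" where
  "out_arc D c = (THE a. a \<in> arcs D \<and> component_of a = fst (under_pt D c) \<and>
     (\<forall>\<^sub>F s in at_right (snd (under_pt D c)). s \<in> snd a))"

text \<open>The underpassing strand runs from the right of the overpassing strand to its left.\<close>

definition right_to_left :: "diagram \<Rightarrow> complex \<Rightarrow> bool" where
  "right_to_left D c \<longleftrightarrow>
     plane_det (tangent D (over_pt D c)) (tangent D (under_pt D c)) > 0"

definition right_arc :: "diagram \<Rightarrow> complex \<Rightarrow> arc" where
  "right_arc D c = (if right_to_left D c then in_arc D c else out_arc D c)"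

definition left_arc :: "diagram \<Rightarrow> complex \<Rightarrow> arc" where
  "left_arc D c = (if right_to_left D c then out_arc D c else in_arc D c)"

definition writhe :: "diagram \<Rightarrow> complex \<Rightarrow> int" where
  "writhe D c = (if right_to_left D c then 1 else -1)"


section \<open>Modules over the Laurent polynomial ring\<close>

text \<open>\<open>\<int>[t, t\<^sup>-\<^sup>1]\<close> as the group ring of \<open>\<int>\<close>: the exponent is the key.\<close>

type_synonym laurent = "int \<Rightarrow>\<^sub>0 int"

definition t_var :: laurent where
  "t_var = Poly_Mapping.single 1 1"

definition Laurent :: "laurent ring" where
  "Laurent = \<lparr>carrier = UNIV, monoid.mult = (*), one = 1, zero = 0, add = (+)\<rparr>"

definition scale :: "laurent \<Rightarrow> ('a \<Rightarrow>\<^sub>0 laurent) \<Rightarrow> ('a \<Rightarrow>\<^sub>0 laurent)" where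
  "scale r f = Poly_Mapping.map ((*) r) f"

definition gen :: "'a \<Rightarrow> ('a \<Rightarrow>\<^sub>0 laurent)" where
  "gen x = Poly_Mapping.single x 1"

definition free_module :: "'a set \<Rightarrow> (laurent, 'a \<Rightarrow>\<^sub>0 laurent) module" where
  "free_module X = \<lparr>carrier = {f. Poly_Mapping.keys f \<subseteq> X}, monoid.mult = undefined,
     one = undefined, zero = 0, add = (+), smult = scale\<rparr>"

definition quotient_module :: "('r, 'm) module \<Rightarrow> 'm set \<Rightarrow> ('r, 'm set) module" where
  "quotient_module M N = \<lparr>carrier = a_rcosets\<^bsub>M\<^esub> N, monoid.mult = undefined,
     one = undefined, zero = N, add = set_add M,
     smult = (\<lambda>r X. \<Union>x\<in>X. N +>\<^bsub>M\<^esub> (r \<odot>\<^bsub>M\<^esub> x))\<rparr>"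

definition generated_submodule :: "'r ring \<Rightarrow> ('r, 'm) module \<Rightarrow> 'm set \<Rightarrow> 'm set" where
  "generated_submodule R M S = \<Inter>{N. submodule N R M \<and> S \<subseteq> N}"


section \<open>The reduced Alexander module and the longitudes\<close>

definition rho_gen :: "diagram \<Rightarrow> complex \<Rightarrow> (arc \<Rightarrow>\<^sub>0 laurent)" where
  "rho_gen D c = scale (1 - t_var) (gen (over_arc D c))
     + scale t_var (gen (right_arc D c)) - gen (left_arc D c)"

definition rho :: "diagram \<Rightarrow> (complex \<Rightarrow>\<^sub>0 laurent) \<Rightarrow> (arc \<Rightarrow>\<^sub>0 laurent)" where
  "rho D f = (\<Sum>c\<in>Poly_Mapping.keys f. scale (Poly_Mapping.lookup f c) (rho_gen D c))"

definition rho_image :: "diagram \<Rightarrow> (arc \<Rightarrow>\<^sub>0 laurent) set" where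
  "rho_image D = rho D ` carrier (free_module (crossings D))"

definition red_alexander :: "diagram \<Rightarrow> (laurent, (arc \<Rightarrow>\<^sub>0 laurent) set) module" where
  "red_alexander D = quotient_module (free_module (arcs D)) (rho_image D)"

definition quot_map :: "diagram \<Rightarrow> (arc \<Rightarrow>\<^sub>0 laurent) \<Rightarrow> (arc \<Rightarrow>\<^sub>0 laurent) set" where
  "quot_map D x = rho_image D +>\<^bsub>free_module (arcs D)\<^esub> x"

definition under_crossings :: "diagram \<Rightarrow> nat \<Rightarrow> complex set" where
  "under_crossings D i = {c \<in> crossings D. component_of (right_arc D c) = i}"

text \<open>The unique \<open>y\<close> with \<open>2y = x\<close>, for those \<open>x\<close> all of whose coefficients are even.\<close>

definition half :: "('a \<Rightarrow>\<^sub>0 laurent) \<Rightarrow> ('a \<Rightarrow>\<^sub>0 laurent)" where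
  "half x = (THE y. y + y = x)"

definition longitude :: "diagram \<Rightarrow> nat \<Rightarrow> (arc \<Rightarrow>\<^sub>0 laurent) set" where
  "longitude D i = quot_map D
     ((\<Sum>c\<in>under_crossings D i. scale (of_int (writhe D c)) (gen (over_arc D c)))
      - half (\<Sum>c\<in>under_crossings D i.
          scale (of_int (writhe D c)) (gen (right_arc D c) + gen (left_arc D c))))"

end

theory Submission
  imports Defs
begin

text \<open>
  Write \<open>U\<^sub>i\<close> for the crossings at which the \<open>i\<close>-th component passes under.  On a component with cuts,
  the incoming and the outgoing underpassing arcs at \<open>U\<^sub>i\<close> are the same arcs in cyclic order.  The telescoping
  sum along this cycle shows that the representative \<open>l\<^sub>i\<close> of \<open>\<chi>\<^sub>i\<close> satisfies, in the free module,
  \<open>(1 - t) l\<^sub>i = (\<Sum>c\<in>U\<^sub>i. w(c) \<rho>(c))\<close>.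

  Conversely, let \<open>(1 - t) x = \<rho>(h)\<close>.  Setting \<open>t = 1\<close> turns \<open>\<rho>(c)\<close> into \<open>w(c)\<close> times the incoming minus the
  outgoing arc, so the integer \<open>w(c) h(c)(1)\<close> is a constant \<open>m\<^sub>i\<close> on each \<open>U\<^sub>i\<close>.  Since \<open>1 - t\<close> divides
  \<open>h(c) - h(c)(1)\<close>, this gives \<open>(1 - t) x = (1 - t) (\<Sum>i. m\<^sub>i l\<^sub>i) + (1 - t) \<rho>(g)\<close>, and \<open>1 - t\<close> cancels because
  the free module is torsion-free.
\<close>

section \<open>Gaps of periodic discrete sets\<close>

definition consecutive :: "real set \<Rightarrow> real \<Rightarrow> real \<Rightarrow> bool" where
  "consecutive K l r \<longleftrightarrow> l \<in> K \<and> r \<in> K \<and> l < r \<and> {l<..<r} \<inter> K = {}"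

text \<open>The full preimage in the line of the image of an open interval in the circle of length
  1. This is the form in which \<open>arcs\<close> records an arc, so arcs can be compared with gaps
  as sets.\<close>

definition periodic_gap :: "real \<Rightarrow> real \<Rightarrow> real set" where
  "periodic_gap l r = {x. \<exists>n::int. x + of_int n \<in> {l<..<r}}"

text \<open>Abstracts what the arc structure needs from \<open>cuts D i\<close>: it is the preimage
  of a finite, possibly empty, subset of the circle.\<close>

locale periodic_discrete =
  fixes K :: "real set"
  assumes shift_iff: "s + of_int n \<in> K \<longleftrightarrow> s \<in> K"
    and finite_bounded: "finite (K \<inter> {a..b})"
begin

text \<open>\<open>k\<close> only witnesses that \<open>K\<close> is nonempty. By periodicity the
  window of length 1 to the right of \<open>s\<close> then meets \<open>K\<close>, and since it does
  so in a finite set, a minimum exists.\<close>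

lemma next_element:
  assumes "k \<in> K"
  obtains r where "r \<in> K" "s < r" "{s<..<r} \<inter> K = {}"
proof -
  define T where "T = K \<inter> {s<..s+1}"
  have "T \<subseteq> K \<inter> {s..s+1}" by (auto simp: T_def)
  then have fin: "finite T" by (rule finite_subset) (rule finite_bounded)
  \<comment> \<open>The first translate of \<open>k\<close> strictly beyond \<open>s\<close>; it
    overshoots by at most 1.\<close>
  have "k + of_int (\<lfloor>s - k\<rfloor> + 1) \<in> K" using assms shift_iff by blast
  moreover have "s < k + of_int (\<lfloor>s - k\<rfloor> + 1)" "k + of_int (\<lfloor>s - k\<rfloor> + 1) \<le> s + 1"
    using floor_correct[of "s - k"] by linarith+
  ultimately have ne: "T \<noteq> {}" by (auto simp: T_def)
  have "Min T \<in> T" using fin ne by (rule Min_in)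
  moreover have "x \<notin> K" if "s < x" "x < Min T" for x
  proof
    assume "x \<in> K"
    then have "x \<in> T" using that \<open>Min T \<in> T\<close> by (auto simp: T_def)
    then show False using Min_le[OF fin] that by fastforce
  qed
  ultimately show ?thesis by (intro that[of "Min T"]) (auto simp: T_def)
qed

lemma previous_element:
  assumes "k \<in> K"
  obtains l where "l \<in> K" "l < s" "{l<..<s} \<inter> K = {}"
proof -
  define T where "T = K \<inter> {s-1..<s}"
  have "T \<subseteq> K \<inter> {s-1..s}" by (auto simp: T_def)
  then have fin: "finite T" by (rule finite_subset) (rule finite_bounded)
  \<comment> \<open>The last translate of \<open>k\<close> strictly before \<open>s\<close>; the
    ceiling replaces the floor because the window is now open at its right end.\<close>
  have "k + of_int (\<lceil>s - k\<rceil> - 1) \<in> K" using assms shift_iff by blast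
  moreover have "k + of_int (\<lceil>s - k\<rceil> - 1) < s" "s - 1 \<le> k + of_int (\<lceil>s - k\<rceil> - 1)"
    using ceiling_correct[of "s - k"] by linarith+
  ultimately have ne: "T \<noteq> {}" by (auto simp: T_def)
  have "Max T \<in> T" using fin ne by (rule Max_in)
  moreover have "x \<notin> K" if "x < s" "Max T < x" for x
  proof
    assume "x \<in> K"
    then have "x \<in> T" using that \<open>Max T \<in> T\<close> by (auto simp: T_def)
    then show False using Max_ge[OF fin] that by fastforce
  qed
  ultimately show ?thesis by (intro that[of "Max T"]) (auto simp: T_def)
qed

lemma consecutive_after: "k \<in> K \<Longrightarrow> \<exists>r. consecutive K k r"
  by (rule next_element[of k k]) (auto simp: consecutive_def)

lemma consecutive_before: "k \<in> K \<Longrightarrow> \<exists>l. consecutive K l k"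
  by (rule previous_element[of k k]) (auto simp: consecutive_def)

lemma consecutive_around:
  assumes "k \<in> K" "s \<notin> K"
  shows "\<exists>l r. consecutive K l r \<and> l < s \<and> s < r"
proof -
  obtain r where r: "r \<in> K" "s < r" "{s<..<r} \<inter> K = {}" using next_element assms(1) .
  obtain l where l: "l \<in> K" "l < s" "{l<..<s} \<inter> K = {}" using previous_element assms(1) .
  have "x \<notin> K" if "l < x" "x < r" for x
    using that l(3) r(3) assms(2) by (cases x s rule: linorder_cases) auto
  then show ?thesis using l r unfolding consecutive_def by (intro exI[of _ l] exI[of _ r]) auto
qed

lemma consecutive_shift: "consecutive K (l + of_int n) (r + of_int n) \<longleftrightarrow> consecutive K l r"
proof -
  have "consecutive K (l + of_int n) (r + of_int n)" if c: "consecutive K l r" for l r and n :: int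
  proof -
    have "x \<notin> K" if "l + of_int n < x" "x < r + of_int n" for x
      using that c shift_iff[of x "- n"] unfolding consecutive_def by force
    then show ?thesis using c by (auto simp: consecutive_def shift_iff)
  qed
  from this[of l r n] this[of "l + of_int n" "r + of_int n" "- n"] show ?thesis by auto
qed

text \<open>End points lie in \<open>K\<close>, so none of them can be interior to the other gap;
  two overlapping gaps therefore coincide.\<close>

lemma consecutive_unique:
  assumes "consecutive K l r" "consecutive K l' r'" "s \<in> {l<..<r}" "s \<in> {l'<..<r'}"
  shows "l = l'" "r = r'"
proof -
  have "l' \<notin> {l<..<r}" "l \<notin> {l'<..<r'}" "r' \<notin> {l<..<r}" "r \<notin> {l'<..<r'}"
    using assms(1,2) unfolding consecutive_def by blast+
  then show "l = l'" "r = r'" using assms(3,4) by auto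
qed

text \<open>Translating one gap so that both contain the same representative of \<open>x\<close>
  reduces this to \<open>consecutive_unique\<close>. It recovers the ends of an arc, up to a common
  integer, from the arc as a set.\<close>

lemma periodic_gap_inter:
  assumes "consecutive K l r" "consecutive K l' r'" "x \<in> periodic_gap l r" "x \<in> periodic_gap l' r'"
  shows "\<exists>n::int. l' = l + of_int n \<and> r' = r + of_int n"
proof -
  obtain n m :: int where nm: "x + of_int n \<in> {l<..<r}" "x + of_int m \<in> {l'<..<r'}"
    using assms(3,4) unfolding periodic_gap_def by blast
  have "consecutive K (l + of_int (m - n)) (r + of_int (m - n))"
    using assms(1) consecutive_shift by blast
  moreover have "x + of_int m \<in> {l + of_int (m - n)<..<r + of_int (m - n)}" using nm(1) by auto
  ultimately show ?thesis using consecutive_unique[OF _ assms(2) _ nm(2)] by metis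
qed

lemma periodic_gap_nonempty: "l < r \<Longrightarrow> (l + r) / 2 \<in> periodic_gap l r"
  unfolding periodic_gap_def by (auto intro!: exI[of _ 0])

lemma periodic_gap_shift: "periodic_gap (l + of_int n) (r + of_int n) = periodic_gap l r"
proof -
  have "periodic_gap l r \<subseteq> periodic_gap (l + of_int n) (r + of_int n)" for l r and n :: int
  proof
    fix x assume "x \<in> periodic_gap l r"
    then obtain m :: int where "x + of_int m \<in> {l<..<r}" unfolding periodic_gap_def by blast
    then have "x + of_int (m + n) \<in> {l + of_int n<..<r + of_int n}" by auto
    then show "x \<in> periodic_gap (l + of_int n) (r + of_int n)" unfolding periodic_gap_def by blast
  qed
  from this[of l r n] this[of "l + of_int n" "r + of_int n" "- n"] show ?thesis by auto
qed

text \<open>A connected set of reals is an interval, so a component that reached beyond an end of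
  the gap would contain that end, which belongs to \<open>K\<close>.\<close>

lemma component_eq_gap:
  assumes c: "consecutive K l r" and s: "s \<in> {l<..<r}"
  shows "connected_component_set (- K) s = {l<..<r}"
proof
  have "{l<..<r} \<subseteq> - K" using c by (auto simp: consecutive_def)
  then show "{l<..<r} \<subseteq> connected_component_set (- K) s"
    using s by (intro connected_component_maximal) auto
next
  let ?C = "connected_component_set (- K) s"
  have sub: "?C \<subseteq> - K" by (rule connected_component_subset)
  have "s \<in> - K" using c s by (auto simp: consecutive_def)
  then have sC: "s \<in> ?C" by simp
  have int: "is_interval ?C" by (simp add: is_interval_connected_1)
  have lr: "l \<notin> ?C" "r \<notin> ?C" using sub c by (auto simp: consecutive_def)
  show "?C \<subseteq> {l<..<r}"
  proof
    fix x assume x: "x \<in> ?C"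
    have "\<not> x \<le> l" using mem_is_interval_1_I[OF int x sC, of l] lr s by auto
    moreover have "\<not> r \<le> x" using mem_is_interval_1_I[OF int sC x, of r] lr s by auto
    ultimately show "x \<in> {l<..<r}" by auto
  qed
qed

end

section \<open>Arcs between consecutive cuts\<close>

context
  fixes D :: diagram
  assumes link_D: "link_diagram D"
begin

section \<open>Crossings, underpassages and cut points\<close>

lemma finite_crossings: "finite (crossings D)"
  using link_D unfolding link_diagram_def by (meson finite_subset)

lemma under_pt_props:
  assumes "c \<in> crossings D"
  shows "under_pt D c \<in> passages D c" "under_pt D c \<noteq> over_pt D c" "over_pt D c \<in> passages D c"
proof -
  obtain p q where pq: "p \<noteq> q" "passages D c = {p, q}"
    using link_D assms unfolding link_diagram_def by (meson subsetD)
  show o: "over_pt D c \<in> passages D c" using link_D assms unfolding link_diagram_def by blast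
  have "\<exists>!p. p \<in> passages D c \<and> p \<noteq> over_pt D c" using pq o by auto
  from theI'[OF this] show "under_pt D c \<in> passages D c" "under_pt D c \<noteq> over_pt D c"
    unfolding under_pt_def by auto
qed

lemma under_pt_coords:
  assumes "c \<in> crossings D"
  shows "fst (under_pt D c) \<in> {1..ncomp D}" "0 \<le> snd (under_pt D c)" "snd (under_pt D c) < 1"
    "frac (snd (under_pt D c)) = snd (under_pt D c)"
  using under_pt_props(1)[OF assms] by (auto simp: passages_def params_def frac_eq)

lemma under_pt_inj: "inj_on (under_pt D) (crossings D)"
  by (rule inj_on_inverseI[where g = "pos D"]) (use under_pt_props in \<open>auto simp: passages_def\<close>)

lemma under_pt_mem_cuts: "c \<in> crossings D \<Longrightarrow> snd (under_pt D c) \<in> cuts D (fst (under_pt D c))"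
  unfolding cuts_def using under_pt_coords(4) by (auto intro!: bexI[of _ c])

lemma cuts_periodic_discrete: "periodic_discrete (cuts D i)"
proof
  show "s + of_int n \<in> cuts D i \<longleftrightarrow> s \<in> cuts D i" for s and n :: int
    by (simp add: cuts_def frac_def)
  show "finite (cuts D i \<inter> {a..b})" for a b
  proof -
    let ?F = "(\<lambda>c. snd (under_pt D c)) ` crossings D"
    \<comment> \<open>A cut is determined by its fractional part, of which there are finitely many,
      and its integer part, which is bounded here.\<close>
    have "cuts D i \<inter> {a..b} \<subseteq> (\<Union>n\<in>{\<lfloor>a\<rfloor>..\<lfloor>b\<rfloor>}. (\<lambda>u. u + of_int n) ` ?F)"
    proof
      fix s assume s: "s \<in> cuts D i \<inter> {a..b}"
      then obtain c where c: "c \<in> crossings D" "under_pt D c = (i, frac s)" unfolding cuts_def by auto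
      have "s = snd (under_pt D c) + of_int \<lfloor>s\<rfloor>" using c by (simp add: frac_def)
      moreover have "\<lfloor>s\<rfloor> \<in> {\<lfloor>a\<rfloor>..\<lfloor>b\<rfloor>}" using s by (auto intro: floor_mono)
      ultimately show "s \<in> (\<Union>n\<in>{\<lfloor>a\<rfloor>..\<lfloor>b\<rfloor>}. (\<lambda>u. u + of_int n) ` ?F)" using c by blast
    qed
    then show ?thesis by (rule finite_subset) (auto simp: finite_crossings)
  qed
qed

lemma crossing_at_cut:
  assumes "k \<in> cuts D i"
  obtains c n where "c \<in> crossings D" "fst (under_pt D c) = i" "k = snd (under_pt D c) + of_int n"
proof -
  obtain c where "c \<in> crossings D" "under_pt D c = (i, frac k)" using assms unfolding cuts_def by auto
  then show ?thesis using that[of c "\<lfloor>k\<rfloor>"] by (simp add: frac_def)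
qed

section \<open>Identification of arcs with gaps\<close>

lemma arc_at_eq_gap:
  assumes "consecutive (cuts D i) l r" "s \<in> {l<..<r}"
  shows "arc_at D (i, s) = (i, periodic_gap l r)"
proof -
  have "connected_component (- cuts D i) s x \<longleftrightarrow> x \<in> {l<..<r}" for x
    using periodic_discrete.component_eq_gap[OF cuts_periodic_discrete assms] by auto
  then show ?thesis by (simp add: arc_at_def periodic_gap_def)
qed

lemma gap_mem_arcs:
  assumes "consecutive (cuts D i) l r" "i \<in> {1..ncomp D}"
  shows "(i, periodic_gap l r) \<in> arcs D"
proof -
  have m: "(l + r) / 2 \<in> {l<..<r}" using assms by (auto simp: consecutive_def)
  then have "(l + r) / 2 \<notin> cuts D i" using assms(1) unfolding consecutive_def by blast
  then show ?thesis using arc_at_eq_gap[OF assms(1) m] assms(2) unfolding arcs_def by force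
qed

text \<open>The cut \<open>k\<close> excludes a component that never passes under, whose only arc is
  the whole circle and has no ends.\<close>

lemma arcs_are_gaps:
  assumes "a \<in> arcs D" "k \<in> cuts D (component_of a)"
  obtains l r where "consecutive (cuts D (component_of a)) l r" "a = (component_of a, periodic_gap l r)"
proof -
  obtain i s where a: "a = arc_at D (i, s)" "s \<notin> cuts D i" using assms(1) unfolding arcs_def by blast
  have i: "component_of a = i" by (simp add: a component_of_def arc_at_def)
  obtain l r where "consecutive (cuts D i) l r" "l < s" "s < r"
    using periodic_discrete.consecutive_around[OF cuts_periodic_discrete] assms(2) a(2) i by metis
  moreover from this have "a = (component_of a, periodic_gap l r)"
    using arc_at_eq_gap[of i l r s] a(1) i by simp
  ultimately show ?thesis using that i by blast
qed

text \<open>Arcs with a common point agree. The uniqueness hidden in \<open>in_arc\<close> and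
  \<open>out_arc\<close> is thereby reduced to exhibiting one such point.\<close>

lemma arc_eqI:
  assumes "a \<in> arcs D" "component_of a = i" "consecutive (cuts D i) l r"
    "x \<in> snd a" "x \<in> periodic_gap l r"
  shows "a = (i, periodic_gap l r)"
proof -
  have "l \<in> cuts D (component_of a)" using assms by (simp add: consecutive_def)
  then obtain l' r' where l': "consecutive (cuts D i) l' r'" "a = (i, periodic_gap l' r')"
    using arcs_are_gaps assms(1,2) by metis
  interpret periodic_discrete "cuts D i" by (rule cuts_periodic_discrete)
  from periodic_gap_inter[OF assms(3) l'(1) assms(5)] assms(4) l'(2) obtain n :: int
    where "l' = l + of_int n" "r' = r + of_int n" by auto
  then show ?thesis using l' periodic_gap_shift by auto
qed

text \<open>Just before the underpassage the parameter runs through the gap that ends there, and any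
  arc with the defining property of \<open>in_arc\<close> meets this gap near the cut. The integer
  \<open>n\<close> allows \<open>r\<close> to lie in any period, whereas the parameter of a crossing
  lies in the first one.\<close>

lemma in_arc_eq_gap:
  assumes c: "c \<in> crossings D" and cons: "consecutive (cuts D i) l r"
    and u: "fst (under_pt D c) = i" "r = snd (under_pt D c) + of_int n"
  shows "in_arc D c = (i, periodic_gap l r)"
proof -
  let ?u = "snd (under_pt D c)"
  have i: "i \<in> {1..ncomp D}" using under_pt_coords(1)[OF c] u by simp
  have "l - of_int n < ?u" using cons u by (auto simp: consecutive_def)
  then have "\<forall>\<^sub>F s in at_left ?u. s \<in> {l - of_int n<..<?u}" by (intro eventually_at_leftI) auto
  then have ev: "\<forall>\<^sub>F s in at_left ?u. s \<in> periodic_gap l r"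
    by (rule eventually_mono) (auto simp: periodic_gap_def u intro!: exI[of _ n])
  show ?thesis unfolding in_arc_def
  proof (rule the_equality)
    show "(i, periodic_gap l r) \<in> arcs D \<and> component_of (i, periodic_gap l r) = fst (under_pt D c) \<and>
      (\<forall>\<^sub>F s in at_left ?u. s \<in> snd (i, periodic_gap l r))"
      using gap_mem_arcs[OF cons i] ev u by (simp add: component_of_def)
  next
    fix a assume a: "a \<in> arcs D \<and> component_of a = fst (under_pt D c) \<and> (\<forall>\<^sub>F s in at_left ?u. s \<in> snd a)"
    \<comment> \<open>The left-hand filter is nontrivial, so two eventual properties hold together
      at some point.\<close>
    then have "\<forall>\<^sub>F s in at_left ?u. s \<in> snd a \<and> s \<in> periodic_gap l r" using ev eventually_conj by blast
    then have "\<exists>x. x \<in> snd a \<and> x \<in> periodic_gap l r"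
      by (rule eventually_happens'[rotated]) simp
    then obtain x where "x \<in> snd a" "x \<in> periodic_gap l r" by blast
    then show "a = (i, periodic_gap l r)" using arc_eqI cons a u by blast
  qed
qed

text \<open>Mirror image of \<open>in_arc_eq_gap\<close>, with the gap that begins at the
  underpassage.\<close>

lemma out_arc_eq_gap:
  assumes c: "c \<in> crossings D" and cons: "consecutive (cuts D i) l r"
    and u: "fst (under_pt D c) = i" "l = snd (under_pt D c) + of_int n"
  shows "out_arc D c = (i, periodic_gap l r)"
proof -
  let ?u = "snd (under_pt D c)"
  have i: "i \<in> {1..ncomp D}" using under_pt_coords(1)[OF c] u by simp
  have "?u < r - of_int n" using cons u by (auto simp: consecutive_def)
  then have "\<forall>\<^sub>F s in at_right ?u. s \<in> {?u<..<r - of_int n}"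
    by (intro eventually_at_rightI) auto
  then have ev: "\<forall>\<^sub>F s in at_right ?u. s \<in> periodic_gap l r"
    by (rule eventually_mono) (auto simp: periodic_gap_def u intro!: exI[of _ n])
  show ?thesis unfolding out_arc_def
  proof (rule the_equality)
    show "(i, periodic_gap l r) \<in> arcs D \<and> component_of (i, periodic_gap l r) = fst (under_pt D c) \<and>
      (\<forall>\<^sub>F s in at_right ?u. s \<in> snd (i, periodic_gap l r))"
      using gap_mem_arcs[OF cons i] ev u by (simp add: component_of_def)
  next
    fix a assume a: "a \<in> arcs D \<and> component_of a = fst (under_pt D c) \<and> (\<forall>\<^sub>F s in at_right ?u. s \<in> snd a)"
    then have "\<forall>\<^sub>F s in at_right ?u. s \<in> snd a \<and> s \<in> periodic_gap l r" using ev eventually_conj by blast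
    then have "\<exists>x. x \<in> snd a \<and> x \<in> periodic_gap l r"
      by (rule eventually_happens'[rotated]) simp
    then obtain x where "x \<in> snd a" "x \<in> periodic_gap l r" by blast
    then show "a = (i, periodic_gap l r)" using arc_eqI cons a u by blast
  qed
qed

lemma in_arc_gap:
  assumes "c \<in> crossings D"
  obtains l where "consecutive (cuts D (fst (under_pt D c))) l (snd (under_pt D c))"
    "in_arc D c = (fst (under_pt D c), periodic_gap l (snd (under_pt D c)))"
proof -
  obtain k where k: "consecutive (cuts D (fst (under_pt D c))) k (snd (under_pt D c))"
    using periodic_discrete.consecutive_before[OF cuts_periodic_discrete under_pt_mem_cuts[OF assms]] ..
  show ?thesis using that[OF k] in_arc_eq_gap[OF assms k refl, of 0] by simp
qed

lemma out_arc_gap: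
  assumes "c \<in> crossings D"
  obtains r where "consecutive (cuts D (fst (under_pt D c))) (snd (under_pt D c)) r"
    "out_arc D c = (fst (under_pt D c), periodic_gap (snd (under_pt D c)) r)"
proof -
  obtain k where k: "consecutive (cuts D (fst (under_pt D c))) (snd (under_pt D c)) k"
    using periodic_discrete.consecutive_after[OF cuts_periodic_discrete under_pt_mem_cuts[OF assms]] ..
  show ?thesis using that[OF k] out_arc_eq_gap[OF assms k refl, of 0] by simp
qed

section \<open>Incidence of arcs and crossings\<close>

lemma in_arc_mem: "c \<in> crossings D \<Longrightarrow> in_arc D c \<in> arcs D"
  using in_arc_gap gap_mem_arcs under_pt_coords(1) by metis

lemma out_arc_mem: "c \<in> crossings D \<Longrightarrow> out_arc D c \<in> arcs D"
  using out_arc_gap gap_mem_arcs under_pt_coords(1) by metis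

lemma component_in_arc: "c \<in> crossings D \<Longrightarrow> component_of (in_arc D c) = fst (under_pt D c)"
  by (metis component_of_def fst_conv in_arc_gap)

lemma component_out_arc: "c \<in> crossings D \<Longrightarrow> component_of (out_arc D c) = fst (under_pt D c)"
  by (metis component_of_def fst_conv out_arc_gap)

lemma over_arc_mem:
  assumes "c \<in> crossings D"
  shows "over_arc D c \<in> arcs D"
proof -
  obtain i s where o: "over_pt D c = (i, s)" by force
  have p: "i \<in> {1..ncomp D}" "0 \<le> s" "s < 1"
    using under_pt_props(3)[OF assms] o by (auto simp: passages_def params_def)
  \<comment> \<open>A cut here would be the underpassage of a crossing at the same point of the
    plane, hence of \<open>c\<close> itself, whose two passages differ.\<close>
  have "s \<notin> cuts D i"
  proof
    assume "s \<in> cuts D i"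
    then obtain c' where c': "c' \<in> crossings D" "under_pt D c' = over_pt D c"
      using p by (auto simp: cuts_def o frac_eq)
    then have "c' = c" using under_pt_props[OF c'(1)] under_pt_props[OF assms] by (auto simp: passages_def)
    then show False using c' under_pt_props(2) by blast
  qed
  then show ?thesis using p unfolding over_arc_def arcs_def o by blast
qed

lemma eq_of_congruent_params:
  assumes "c \<in> crossings D" "c' \<in> crossings D" "fst (under_pt D c) = fst (under_pt D c')"
    "snd (under_pt D c') = snd (under_pt D c) + of_int n"
  shows "c = c'"
proof -
  have "frac (snd (under_pt D c')) = frac (snd (under_pt D c))" using assms(4) by (simp add: frac_def)
  then have "under_pt D c = under_pt D c'"
    using assms(3) under_pt_coords(4)[OF assms(1)] under_pt_coords(4)[OF assms(2)] by (simp add: prod_eq_iff)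
  then show ?thesis using inj_onD[OF under_pt_inj] assms by blast
qed

text \<open>An arc determines its terminal parameter modulo 1, and underpassages are distinct modulo
  1. For \<open>inj_out_arc\<close> the initial parameter is used instead.\<close>

lemma inj_in_arc: "inj_on (in_arc D) (crossings D)"
proof (rule inj_onI)
  fix c c' assume c: "c \<in> crossings D" and c': "c' \<in> crossings D" and eq: "in_arc D c = in_arc D c'"
  obtain l where l: "consecutive (cuts D (fst (under_pt D c))) l (snd (under_pt D c))"
    "in_arc D c = (fst (under_pt D c), periodic_gap l (snd (under_pt D c)))" using in_arc_gap[OF c] .
  obtain l' where l': "consecutive (cuts D (fst (under_pt D c'))) l' (snd (under_pt D c'))"
    "in_arc D c' = (fst (under_pt D c'), periodic_gap l' (snd (under_pt D c')))" using in_arc_gap[OF c'] .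
  interpret periodic_discrete "cuts D (fst (under_pt D c))" by (rule cuts_periodic_discrete)
  obtain x where "x \<in> periodic_gap l (snd (under_pt D c))"
    using periodic_gap_nonempty l(1) unfolding consecutive_def by blast
  then obtain n :: int where "snd (under_pt D c') = snd (under_pt D c) + of_int n"
    using periodic_gap_inter[OF l(1), of l' "snd (under_pt D c')" x] l l' eq by auto
  then show "c = c'" using eq_of_congruent_params[OF c c'] component_in_arc[OF c] component_in_arc[OF c'] eq by metis
qed

lemma inj_out_arc: "inj_on (out_arc D) (crossings D)"
proof (rule inj_onI)
  fix c c' assume c: "c \<in> crossings D" and c': "c' \<in> crossings D" and eq: "out_arc D c = out_arc D c'"
  obtain r where r: "consecutive (cuts D (fst (under_pt D c))) (snd (under_pt D c)) r"
    "out_arc D c = (fst (under_pt D c), periodic_gap (snd (under_pt D c)) r)" using out_arc_gap[OF c] .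
  obtain r' where r': "consecutive (cuts D (fst (under_pt D c'))) (snd (under_pt D c')) r'"
    "out_arc D c' = (fst (under_pt D c'), periodic_gap (snd (under_pt D c')) r')" using out_arc_gap[OF c'] .
  interpret periodic_discrete "cuts D (fst (under_pt D c))" by (rule cuts_periodic_discrete)
  obtain x where "x \<in> periodic_gap (snd (under_pt D c)) r"
    using periodic_gap_nonempty r(1) unfolding consecutive_def by blast
  then obtain n :: int where "snd (under_pt D c') = snd (under_pt D c) + of_int n"
    using periodic_gap_inter[OF r(1), of "snd (under_pt D c')" r' x] r r' eq by auto
  then show "c = c'" using eq_of_congruent_params[OF c c'] component_out_arc[OF c] component_out_arc[OF c'] eq by metis
qed

section \<open>The cyclic order of the underpassages on a component\<close>

lemma under_crossings_eq: "under_crossings D i = {c \<in> crossings D. fst (under_pt D c) = i}"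
  \<comment> \<open>Both underpassing arcs lie on the component of \<open>under_pt\<close>, so it
    does not matter which of them is the right one.\<close>
  unfolding under_crossings_def right_arc_def using component_in_arc component_out_arc by auto

text \<open>The right end of the outgoing gap is again a cut, and the crossing that causes it is the
  successor.\<close>

lemma next_crossing:
  assumes "c \<in> under_crossings D i"
  shows "\<exists>c'\<in>under_crossings D i. out_arc D c = in_arc D c'"
proof -
  have c: "c \<in> crossings D" "fst (under_pt D c) = i" using assms by (auto simp: under_crossings_eq)
  obtain r where r: "consecutive (cuts D i) (snd (under_pt D c)) r"
    "out_arc D c = (i, periodic_gap (snd (under_pt D c)) r)" using out_arc_gap c by metis
  then have "r \<in> cuts D i" by (simp add: consecutive_def)
  then obtain c' n where c': "c' \<in> crossings D" "fst (under_pt D c') = i" "r = snd (under_pt D c') + of_int n"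
    by (rule crossing_at_cut)
  then show ?thesis using in_arc_eq_gap[OF c'(1) r(1) c'(2,3)] r(2) by (auto simp: under_crossings_eq)
qed

text \<open>One inclusion is \<open>next_crossing\<close>; injectivity gives both finite images the
  same cardinality, so the inclusion is an equality.\<close>

lemma image_in_arc_eq_image_out_arc:
  "in_arc D ` under_crossings D i = out_arc D ` under_crossings D i"
proof -
  let ?U = "under_crossings D i"
  have sub: "?U \<subseteq> crossings D" by (auto simp: under_crossings_def)
  have fin: "finite (in_arc D ` ?U)" using sub finite_crossings finite_subset by blast
  have "card (in_arc D ` ?U) = card (out_arc D ` ?U)"
    using inj_on_subset[OF inj_in_arc sub] inj_on_subset[OF inj_out_arc sub] by (simp add: card_image)
  moreover have "out_arc D ` ?U \<subseteq> in_arc D ` ?U"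
    using next_crossing by (metis image_eqI image_subsetI)
  ultimately show ?thesis using card_subset_eq[OF fin] by metis
qed

text \<open>Any two underpassages of a component are joined by a chain of successors, so a quantity
  preserved by each successor step is constant.\<close>

lemma constant_along_component:
  assumes h: "\<And>c c'. c \<in> under_crossings D i \<Longrightarrow> c' \<in> under_crossings D i \<Longrightarrow>
      out_arc D c = in_arc D c' \<Longrightarrow> h c = h c'"
    and "c \<in> under_crossings D i" "c' \<in> under_crossings D i"
  shows "h c = h c'"
proof -
  interpret periodic_discrete "cuts D i" by (rule cuts_periodic_discrete)
  let ?U = "under_crossings D i" and ?u = "\<lambda>c. snd (under_pt D c)"
  \<comment> \<open>Walking forward from \<open>c\<close> to \<open>c'\<close> stays inside one
    period; the induction is on the number of cuts still to be passed. The opposite order follows by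
    symmetry.\<close>
  have less: "h c = h c'" if "c \<in> ?U" "c' \<in> ?U" "?u c < ?u c'" for c c'
    using that
  proof (induction "card (cuts D i \<inter> {?u c<..?u c'})" arbitrary: c rule: less_induct)
    case less
    have c: "c \<in> crossings D" "fst (under_pt D c) = i" using less.prems by (auto simp: under_crossings_eq)
    have c': "c' \<in> crossings D" "fst (under_pt D c') = i" using less.prems by (auto simp: under_crossings_eq)
    have cut': "?u c' \<in> cuts D i" using under_pt_mem_cuts[OF c'(1)] c'(2) by simp
    obtain r where r: "consecutive (cuts D i) (?u c) r" "out_arc D c = (i, periodic_gap (?u c) r)"
      using out_arc_gap c by metis
    have rK: "r \<in> cuts D i" and ur: "?u c < r" using r by (auto simp: consecutive_def)
    have ru: "r \<le> ?u c'" using r(1) cut' less.prems(3) unfolding consecutive_def by force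
    \<comment> \<open>The next cut lies between two parameters of the first period, so it is the
      parameter of a crossing without any shift.\<close>
    have "frac r = r" using ur ru under_pt_coords[OF c(1)] under_pt_coords[OF c'(1)] by (simp add: frac_eq)
    then obtain d where d: "d \<in> crossings D" "under_pt D d = (i, r)" using rK unfolding cuts_def by auto
    then have dU: "d \<in> ?U" by (simp add: under_crossings_eq)
    have "in_arc D d = (i, periodic_gap (?u c) r)" by (rule in_arc_eq_gap[OF d(1) r(1), of 0]) (simp_all add: d(2))
    then have "in_arc D d = out_arc D c" unfolding r(2) .
    then have hd: "h c = h d" using h less.prems dU by metis
    show ?case
    proof (cases "r = ?u c'")
      case True
      have "d = c'"
        by (rule eq_of_congruent_params[OF d(1) c'(1), of 0]) (simp_all add: d(2) c'(2) True[symmetric])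
      then show ?thesis using hd by simp
    next
      case False
      have fin: "finite (cuts D i \<inter> {?u c<..?u c'})"
        by (rule finite_subset[OF _ finite_bounded[of "?u c" "?u c'"]]) auto
      have "r \<in> cuts D i \<inter> {?u c<..?u c'}" using rK ur ru by simp
      moreover have "cuts D i \<inter> {r<..?u c'} \<subseteq> cuts D i \<inter> {?u c<..?u c'} - {r}" using ur by auto
      ultimately have "cuts D i \<inter> {?u d<..?u c'} \<subset> cuts D i \<inter> {?u c<..?u c'}" using d(2) by auto
      then have "card (cuts D i \<inter> {?u d<..?u c'}) < card (cuts D i \<inter> {?u c<..?u c'})"
        using fin psubset_card_mono by blast
      moreover have "?u d < ?u c'" using False ru by (simp add: d(2))
      ultimately have "h d = h c'" using less.hyps[OF _ dU less.prems(2)] by blast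
      then show ?thesis using hd by simp
    qed
  qed
  have "c = c'" if "?u c = ?u c'"
    by (rule eq_of_congruent_params[of c c' 0])
      (use assms(2,3) that in \<open>simp_all add: under_crossings_eq\<close>)
  then show ?thesis using less[of c c'] less[of c' c] assms(2,3)
    by (metis linorder_less_linear)
qed

end

section \<open>Free modules over the Laurent polynomials and their quotients\<close>

lemma lookup_scale [simp]: "Poly_Mapping.lookup (scale r f) x = r * Poly_Mapping.lookup f x"
  unfolding scale_def by (simp add: Poly_Mapping.map.rep_eq when_def)

lemma scale_zero_left [simp]: "scale 0 f = 0"
  and scale_zero_right [simp]: "scale r 0 = 0"
  and scale_one [simp]: "scale 1 f = f"
  and scale_scale: "scale r (scale s f) = scale (r * s) f"
  and scale_add_left: "scale (r + s) f = scale r f + scale s f"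
  and scale_add_right: "scale r (f + g) = scale r f + scale r g"
  and scale_diff_right: "scale r (f - g) = scale r f - scale r g"
  and scale_minus_left: "scale (- r) f = - scale r f"
  by (rule poly_mapping_eqI; simp add: lookup_add lookup_minus algebra_simps)+

lemma scale_sum_right: "scale r (sum f A) = (\<Sum>a\<in>A. scale r (f a))"
  by (rule poly_mapping_eqI) (simp add: lookup_sum sum_distrib_left)

lemma lookup_gen: "Poly_Mapping.lookup (gen x) y = (if x = y then 1 else 0)"
  by (simp add: gen_def lookup_single when_def)

lemma keys_subset_iff: "Poly_Mapping.keys f \<subseteq> X \<longleftrightarrow> (\<forall>x. x \<notin> X \<longrightarrow> Poly_Mapping.lookup f x = 0)"
  by (auto simp: in_keys_iff)

lemma scale_cancel:
  assumes "r \<noteq> 0" "scale r f = scale r g"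
  shows "f = g"
proof (rule poly_mapping_eqI)
  fix x
  have "Poly_Mapping.lookup (scale r f) x = Poly_Mapping.lookup (scale r g) x" using assms(2) by simp
  then show "Poly_Mapping.lookup f x = Poly_Mapping.lookup g x" using assms(1) by simp
qed

text \<open>Multiplication by 2 is injective on the free module, so any solution is the one chosen
  by \<open>half\<close>.\<close>

lemma half_eqI:
  assumes "y + y = x"
  shows "half x = y"
  unfolding half_def
proof (rule the_equality)
  fix z :: "'a \<Rightarrow>\<^sub>0 laurent" assume "z + z = x"
  then have "scale 2 z = scale 2 y" using assms by (metis scale_add_left scale_one one_add_one)
  then show "z = y" by (rule scale_cancel[rotated]) simp
qed (rule assms)

section \<open>Evaluation at \<open>t = 1\<close> and divisibility by \<open>1 - t\<close>\<close>

lemma one_minus_t_nonzero: "1 - t_var \<noteq> 0"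
proof
  assume "1 - t_var = 0"
  then have "Poly_Mapping.lookup (1 :: laurent) 0 = Poly_Mapping.lookup t_var 0" by simp
  then show False by (simp add: t_var_def lookup_single)
qed

text \<open>Evaluation at \<open>t = 1\<close>.\<close>

definition augmentation :: "laurent \<Rightarrow> int" where
  "augmentation f = (\<Sum>k\<in>Poly_Mapping.keys f. Poly_Mapping.lookup f k)"

lemma augmentation_add: "augmentation (f + g) = augmentation f + augmentation g"
  unfolding augmentation_def by (rule setsum_keys_plus_distrib) auto

lemma augmentation_zero [simp]: "augmentation 0 = 0"
  by (simp add: augmentation_def)

lemma augmentation_single [simp]: "augmentation (Poly_Mapping.single k v) = v"
  by (simp add: augmentation_def)

lemma augmentation_sum: "augmentation (sum f A) = (\<Sum>a\<in>A. augmentation (f a))"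
  by (induction A rule: infinite_finite_induct) (auto simp: augmentation_add)

lemma augmentation_diff: "augmentation (f - g) = augmentation f - augmentation g"
  using augmentation_add[of "f - g" g] by simp

lemma laurent_eq_sum_singles:
  "(f :: laurent) = (\<Sum>k\<in>Poly_Mapping.keys f. Poly_Mapping.single k (Poly_Mapping.lookup f k))"
proof (rule poly_mapping_eqI)
  fix x
  have "(\<Sum>k\<in>Poly_Mapping.keys f. Poly_Mapping.lookup (Poly_Mapping.single k (Poly_Mapping.lookup f k)) x)
      = (\<Sum>k\<in>Poly_Mapping.keys f. if k = x then Poly_Mapping.lookup f k else 0)"
    by (rule sum.cong) (auto simp: lookup_single when_def)
  also have "\<dots> = Poly_Mapping.lookup f x" by (simp add: in_keys_iff)
  finally show "Poly_Mapping.lookup f x = Poly_Mapping.lookup (\<Sum>k\<in>Poly_Mapping.keys f. Poly_Mapping.single k (Poly_Mapping.lookup f k)) x"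
    by (simp add: lookup_sum)
qed

lemma augmentation_t_mult: "augmentation (t_var * f) = augmentation f"
proof -
  have "t_var * f = (\<Sum>k\<in>Poly_Mapping.keys f. Poly_Mapping.single (1 + k) (Poly_Mapping.lookup f k))"
    by (subst laurent_eq_sum_singles) (simp add: sum_distrib_left t_var_def mult_single)
  then show ?thesis by (simp add: augmentation_sum) (simp add: augmentation_def)
qed

text \<open>Induction on the exponent in both directions; the downward step multiplies by the
  inverse of \<open>t\<close>.\<close>

lemma one_minus_t_dvd_single_diff_one: "1 - t_var dvd Poly_Mapping.single k 1 - 1"
proof (induction k rule: int_induct[where k = 0])
  case base
  then show ?case by simp
next
  case (step1 k)
  have "Poly_Mapping.single (k + 1) 1 - 1 = t_var * (Poly_Mapping.single k 1 - 1) - (1 - t_var)"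
    by (simp add: t_var_def mult_single algebra_simps)
  then show ?case using step1 by (metis dvd_diff dvd_mult dvd_refl)
next
  case (step2 k)
  let ?u = "Poly_Mapping.single (- 1) 1 :: laurent"
  have "Poly_Mapping.single (k - 1) 1 - 1 = ?u * (Poly_Mapping.single k 1 - 1) + ?u * (1 - t_var)"
    by (simp add: t_var_def mult_single algebra_simps)
  then show ?case using step2 by (metis dvd_add dvd_mult dvd_refl)
qed

text \<open>Subtracting the value at \<open>t = 1\<close> replaces each power of \<open>t\<close> by
  that power minus 1, and every such difference is divisible.\<close>

lemma one_minus_t_dvd_diff_augmentation: "1 - t_var dvd f - of_int (augmentation f)"
proof -
  have "f - of_int (augmentation f)
      = (\<Sum>k\<in>Poly_Mapping.keys f. Poly_Mapping.single k (Poly_Mapping.lookup f k)) - of_int (augmentation f)"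
    using laurent_eq_sum_singles[of f] by simp
  also have "\<dots> = (\<Sum>k\<in>Poly_Mapping.keys f. of_int (Poly_Mapping.lookup f k) * (Poly_Mapping.single k 1 - 1))"
  proof -
    have "Poly_Mapping.single k (Poly_Mapping.lookup f k) = of_int (Poly_Mapping.lookup f k) * Poly_Mapping.single k 1" for k
      by (simp add: mult_single flip: single_of_int)
    then show ?thesis by (simp add: augmentation_def algebra_simps sum_subtractf)
  qed
  finally show ?thesis using one_minus_t_dvd_single_diff_one by (metis (no_types, lifting) dvd_mult dvd_sum)
qed

section \<open>Quotients of free modules\<close>

lemma cring_Laurent: "cring Laurent"
proof (rule cringI)
  show "abelian_group Laurent"
    by (rule abelian_groupI) (auto simp: Laurent_def algebra_simps intro: exI[of _ "- _"] left_minus)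
  show "comm_monoid Laurent"
    by (rule comm_monoidI) (auto simp: Laurent_def algebra_simps)
qed (auto simp: Laurent_def algebra_simps)

locale free_submodule =
  fixes X :: "'a set" and N :: "('a \<Rightarrow>\<^sub>0 laurent) set"
  assumes mem_carrier: "n \<in> N \<Longrightarrow> Poly_Mapping.keys n \<subseteq> X"
    and zero_mem: "0 \<in> N"
    and add_mem: "m \<in> N \<Longrightarrow> n \<in> N \<Longrightarrow> m + n \<in> N"
    and scale_mem: "n \<in> N \<Longrightarrow> scale r n \<in> N"
begin

abbreviation Q where "Q \<equiv> quotient_module (free_module X) N"

text \<open>Defined for every finitely supported \<open>x\<close>, so coset identities need no side
  condition on the support; the carrier of \<open>Q\<close> selects the representatives supported in
  \<open>X\<close>.\<close>

definition cls :: "('a \<Rightarrow>\<^sub>0 laurent) \<Rightarrow> ('a \<Rightarrow>\<^sub>0 laurent) set" where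
  "cls x = N +>\<^bsub>free_module X\<^esub> x"

lemma diff_mem: "m \<in> N \<Longrightarrow> n \<in> N \<Longrightarrow> m - n \<in> N"
  using add_mem[of m "scale (- 1) n"] scale_mem[of n "- 1"] by (simp add: scale_minus_left)

lemma mem_cls_iff: "y \<in> cls x \<longleftrightarrow> y - x \<in> N"
proof -
  have "y \<in> cls x \<longleftrightarrow> (\<exists>n\<in>N. y = n + x)"
    by (auto simp: cls_def a_r_coset_def' free_module_def)
  then show ?thesis by (metis add_diff_cancel_right' diff_add_cancel)
qed

lemma cls_eq_iff: "cls x = cls y \<longleftrightarrow> x - y \<in> N"
proof
  assume "cls x = cls y"
  then show "x - y \<in> N" using mem_cls_iff[of x x] mem_cls_iff[of x y] zero_mem by simp
next
  assume xy: "x - y \<in> N"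
  have "z - x \<in> N \<longleftrightarrow> z - y \<in> N" for z
    using add_mem[OF _ xy, of "z - x"] diff_mem[OF _ xy, of "z - y"] by auto
  then show "cls x = cls y" by (auto simp: mem_cls_iff)
qed

lemma carrier_Q: "carrier Q = cls ` {x. Poly_Mapping.keys x \<subseteq> X}"
  by (auto simp: quotient_module_def A_RCOSETS_def' cls_def free_module_def)

lemma zero_Q: "\<zero>\<^bsub>Q\<^esub> = cls 0"
  using mem_cls_iff[of _ 0] by (auto simp: quotient_module_def)

lemma add_Q: "cls x \<oplus>\<^bsub>Q\<^esub> cls y = cls (x + y)"
proof -
  have "cls x \<oplus>\<^bsub>Q\<^esub> cls y = {a + b | a b. a \<in> cls x \<and> b \<in> cls y}"
    by (auto simp: quotient_module_def set_add_def' free_module_def)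
  also have "\<dots> = cls (x + y)"
  proof (intro equalityI subsetI)
    fix z assume "z \<in> {a + b | a b. a \<in> cls x \<and> b \<in> cls y}"
    then obtain a b where "z = a + b" "a - x \<in> N" "b - y \<in> N" by (auto simp: mem_cls_iff)
    then show "z \<in> cls (x + y)" using add_mem[of "a - x" "b - y"] by (simp add: mem_cls_iff algebra_simps)
  next
    fix z assume "z \<in> cls (x + y)"
    then have "z = (z - y) + y" "z - y \<in> cls x" "y \<in> cls y"
      using zero_mem by (auto simp: mem_cls_iff algebra_simps)
    then show "z \<in> {a + b | a b. a \<in> cls x \<and> b \<in> cls y}" by blast
  qed
  finally show ?thesis .
qed

text \<open>The product is a union over all representatives, but they all contribute the same coset
  because \<open>N\<close> is closed under scaling.\<close>

lemma smult_Q: "r \<odot>\<^bsub>Q\<^esub> cls x = cls (scale r x)"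
proof -
  have "r \<odot>\<^bsub>Q\<^esub> cls x = (\<Union>y\<in>cls x. cls (scale r y))"
    by (simp add: quotient_module_def cls_def free_module_def)
  also have "\<dots> = (\<Union>y\<in>cls x. cls (scale r x))"
  proof (rule SUP_cong)
    fix y assume "y \<in> cls x"
    then show "cls (scale r y) = cls (scale r x)"
      using scale_mem[of "y - x" r] by (simp add: cls_eq_iff mem_cls_iff scale_diff_right)
  qed simp
  also have "\<dots> = cls (scale r x)" using mem_cls_iff[of x x] zero_mem by auto
  finally show ?thesis .
qed

lemma keys_scale_subset: "Poly_Mapping.keys x \<subseteq> X \<Longrightarrow> Poly_Mapping.keys (scale r x) \<subseteq> X"
  by (auto simp: keys_subset_iff)

lemma module_Q: "module Laurent Q"
proof (rule moduleI)
  show "cring Laurent" by (rule cring_Laurent)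
  show "abelian_group Q"
  proof (rule abelian_groupI)
    fix A assume "A \<in> carrier Q"
    then obtain x where x: "A = cls x" "Poly_Mapping.keys x \<subseteq> X" by (auto simp: carrier_Q)
    then have "cls (scale (- 1) x) \<in> carrier Q" using keys_scale_subset by (auto simp: carrier_Q)
    moreover have "cls (scale (- 1) x) \<oplus>\<^bsub>Q\<^esub> A = \<zero>\<^bsub>Q\<^esub>"
      by (simp add: x add_Q zero_Q scale_minus_left)
    ultimately show "\<exists>B\<in>carrier Q. B \<oplus>\<^bsub>Q\<^esub> A = \<zero>\<^bsub>Q\<^esub>" by blast
  qed (auto simp: carrier_Q add_Q zero_Q algebra_simps keys_subset_iff lookup_add)
qed (auto simp: carrier_Q add_Q smult_Q Laurent_def scale_add_left scale_add_right scale_scale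
    keys_subset_iff)

end

section \<open>Longitudes and the kernel of multiplication by 1 - t\<close>

context
  fixes D :: diagram
  assumes link_D: "link_diagram D"
begin

section \<open>The relation submodule\<close>

lemma right_arc_mem: "c \<in> crossings D \<Longrightarrow> right_arc D c \<in> arcs D"
  and left_arc_mem: "c \<in> crossings D \<Longrightarrow> left_arc D c \<in> arcs D"
  using in_arc_mem[OF link_D] out_arc_mem[OF link_D] by (auto simp: right_arc_def left_arc_def)

lemma lookup_rho_gen:
  "Poly_Mapping.lookup (rho_gen D c) a = (1 - t_var) * (if over_arc D c = a then 1 else 0)
    + t_var * (if right_arc D c = a then 1 else 0) - (if left_arc D c = a then 1 else 0)"
  by (simp add: rho_gen_def lookup_add lookup_minus lookup_gen)

text \<open>Since there are finitely many crossings, finitely supported coefficient vectors may be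
  traded for arbitrary functions on them.\<close>

lemma rho_image_iff:
  "x \<in> rho_image D \<longleftrightarrow> (\<exists>h. x = (\<Sum>c\<in>crossings D. scale (h c) (rho_gen D c)))"
proof
  assume "x \<in> rho_image D"
  then obtain f where f: "Poly_Mapping.keys f \<subseteq> crossings D" "x = rho D f"
    by (auto simp: rho_image_def free_module_def)
  have "x = (\<Sum>c\<in>crossings D. scale (Poly_Mapping.lookup f c) (rho_gen D c))"
    unfolding f(2) rho_def using f(1) finite_crossings[OF link_D]
    by (intro sum.mono_neutral_left) (auto simp: in_keys_iff)
  then show "\<exists>h. x = (\<Sum>c\<in>crossings D. scale (h c) (rho_gen D c))" by (rule exI[of _ "Poly_Mapping.lookup f"])
next
  assume "\<exists>h. x = (\<Sum>c\<in>crossings D. scale (h c) (rho_gen D c))"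
  then obtain h where h: "x = (\<Sum>c\<in>crossings D. scale (h c) (rho_gen D c))" ..
  define f where "f = (\<Sum>c\<in>crossings D. Poly_Mapping.single c (h c))"
  have lf: "Poly_Mapping.lookup f c = (if c \<in> crossings D then h c else 0)" for c
  proof -
    have "Poly_Mapping.lookup f c = (\<Sum>d\<in>crossings D. if d = c then h d else 0)"
      unfolding f_def lookup_sum by (rule sum.cong) (auto simp: lookup_single when_def)
    then show ?thesis using finite_crossings[OF link_D] by simp
  qed
  have keys: "Poly_Mapping.keys f \<subseteq> crossings D" by (auto simp: keys_subset_iff lf)
  have "rho D f = (\<Sum>c\<in>crossings D. scale (Poly_Mapping.lookup f c) (rho_gen D c))"
    unfolding rho_def using keys finite_crossings[OF link_D]
    by (intro sum.mono_neutral_left) (auto simp: in_keys_iff)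
  also have "\<dots> = x" unfolding h by (rule sum.cong) (auto simp: lf)
  finally show "x \<in> rho_image D" using keys by (auto simp: rho_image_def free_module_def)
qed

lemma free_submodule_rho_image: "free_submodule (arcs D) (rho_image D)"
proof
  fix x assume "x \<in> rho_image D"
  then obtain h where h: "x = (\<Sum>c\<in>crossings D. scale (h c) (rho_gen D c))" by (auto simp: rho_image_iff)
  have "Poly_Mapping.lookup (rho_gen D c) a = 0" if "c \<in> crossings D" "a \<notin> arcs D" for c a
    using that over_arc_mem[OF link_D that(1)] left_arc_mem right_arc_mem by (auto simp: lookup_rho_gen)
  then show "Poly_Mapping.keys x \<subseteq> arcs D" by (simp add: h keys_subset_iff lookup_sum)
next
  show "0 \<in> rho_image D" unfolding rho_image_iff by (intro exI[of _ "\<lambda>_. 0"]) simp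
next
  fix x y assume "x \<in> rho_image D" "y \<in> rho_image D"
  then obtain h h' where "x = (\<Sum>c\<in>crossings D. scale (h c) (rho_gen D c))"
    "y = (\<Sum>c\<in>crossings D. scale (h' c) (rho_gen D c))" by (auto simp: rho_image_iff)
  then show "x + y \<in> rho_image D"
    unfolding rho_image_iff by (intro exI[of _ "\<lambda>c. h c + h' c"]) (simp add: scale_add_left sum.distrib)
next
  fix x r assume "x \<in> rho_image D"
  then obtain h where "x = (\<Sum>c\<in>crossings D. scale (h c) (rho_gen D c))" by (auto simp: rho_image_iff)
  then show "scale r x \<in> rho_image D"
    unfolding rho_image_iff by (intro exI[of _ "\<lambda>c. r * h c"]) (simp add: scale_sum_right scale_scale)
qed

section \<open>Representatives of the longitudes\<close>

lemma sum_gen_in_arc_eq_sum_gen_out_arc: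
  "(\<Sum>c\<in>under_crossings D i. gen (in_arc D c)) = (\<Sum>c\<in>under_crossings D i. gen (out_arc D c))"
proof -
  let ?U = "under_crossings D i"
  have sub: "?U \<subseteq> crossings D" by (auto simp: under_crossings_def)
  \<comment> \<open>By injectivity both sums become sums over sets of arcs, and these sets
    coincide.\<close>
  have "(\<Sum>c\<in>?U. gen (in_arc D c)) = (\<Sum>a\<in>in_arc D ` ?U. gen a)"
    by (subst sum.reindex[OF inj_on_subset[OF inj_in_arc[OF link_D] sub]]) simp
  also have "\<dots> = (\<Sum>a\<in>out_arc D ` ?U. gen a)"
    by (simp only: image_in_arc_eq_image_out_arc[OF link_D])
  also have "\<dots> = (\<Sum>c\<in>?U. gen (out_arc D c))"
    by (subst sum.reindex[OF inj_on_subset[OF inj_out_arc[OF link_D] sub]]) simp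
  finally show ?thesis .
qed

text \<open>
  The halves in the longitude disappear: \<open>w(c) (b\<^sub>1(c) + b\<^sub>2(c)) / 2\<close> differs from the bracketed term by half
  the difference of the incoming and the outgoing arc, and these differences sum to zero over a component.
\<close>

definition longitude_rep :: "nat \<Rightarrow> (arc \<Rightarrow>\<^sub>0 laurent)" where
  "longitude_rep i = (\<Sum>c\<in>under_crossings D i. scale (of_int (writhe D c)) (gen (over_arc D c))
     - (if right_to_left D c then gen (in_arc D c) else - gen (out_arc D c)))"

text \<open>Doubling the candidate and subtracting the full sum leaves \<open>in - out\<close> at
  every crossing: it is \<open>2 in - (in + out)\<close> at a positive and
  \<open>- 2 out + (in + out)\<close> at a negative one. These terms telescope to 0.\<close>

lemma half_sum_under_arcs:
  "half (\<Sum>c\<in>under_crossings D i. scale (of_int (writhe D c)) (gen (right_arc D c) + gen (left_arc D c)))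
    = (\<Sum>c\<in>under_crossings D i. if right_to_left D c then gen (in_arc D c) else - gen (out_arc D c))"
    (is "half ?x = ?y")
proof (rule half_eqI)
  have "?y + ?y - ?x = (\<Sum>c\<in>under_crossings D i. gen (in_arc D c) - gen (out_arc D c))"
    unfolding sum.distrib[symmetric] sum_subtractf[symmetric]
    by (rule sum.cong) (auto simp: writhe_def right_arc_def left_arc_def scale_minus_left)
  also have "\<dots> = 0" by (simp add: sum_subtractf sum_gen_in_arc_eq_sum_gen_out_arc)
  finally show "?y + ?y = ?x" by simp
qed

lemma longitude_eq: "longitude D i = quot_map D (longitude_rep i)"
  unfolding longitude_def half_sum_under_arcs by (simp add: longitude_rep_def sum_subtractf)

lemma keys_longitude_rep: "Poly_Mapping.keys (longitude_rep i) \<subseteq> arcs D"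
proof -
  have "Poly_Mapping.lookup (longitude_rep i) a = 0" if "a \<notin> arcs D" for a
    unfolding longitude_rep_def lookup_sum
  proof (rule sum.neutral, rule ballI)
    fix c assume "c \<in> under_crossings D i"
    then have "c \<in> crossings D" by (simp add: under_crossings_def)
    with that over_arc_mem[OF link_D] in_arc_mem[OF link_D] out_arc_mem[OF link_D]
    have "over_arc D c \<noteq> a" "in_arc D c \<noteq> a" "out_arc D c \<noteq> a" by blast+
    then show "Poly_Mapping.lookup (scale (of_int (writhe D c)) (gen (over_arc D c))
      - (if right_to_left D c then gen (in_arc D c) else - gen (out_arc D c))) a = 0"
      by (simp add: lookup_minus lookup_gen)
  qed
  then show ?thesis by (simp add: keys_subset_iff)
qed

text \<open>The representative is chosen so that the defect at each crossing is
  \<open>out - in\<close> for either sign, without any factor \<open>t\<close>; the defects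
  telescope to 0.\<close>

lemma scale_longitude_rep:
  "scale (1 - t_var) (longitude_rep i)
    = (\<Sum>c\<in>under_crossings D i. scale (of_int (writhe D c)) (rho_gen D c))"
proof -
  have "scale (1 - t_var) (longitude_rep i)
      - (\<Sum>c\<in>under_crossings D i. scale (of_int (writhe D c)) (rho_gen D c))
    = (\<Sum>c\<in>under_crossings D i. gen (out_arc D c) - gen (in_arc D c))"
    unfolding longitude_rep_def scale_sum_right sum_subtractf[symmetric]
  proof (rule sum.cong)
    fix c
    show "scale (1 - t_var) (scale (of_int (writhe D c)) (gen (over_arc D c))
        - (if right_to_left D c then gen (in_arc D c) else - gen (out_arc D c)))
        - scale (of_int (writhe D c)) (rho_gen D c) = gen (out_arc D c) - gen (in_arc D c)"
      by (rule poly_mapping_eqI)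
        (simp add: writhe_def rho_gen_def right_arc_def left_arc_def lookup_add lookup_minus algebra_simps)
  qed simp
  also have "\<dots> = 0" by (simp add: sum_subtractf sum_gen_in_arc_eq_sum_gen_out_arc)
  finally show ?thesis by simp
qed

text \<open>Compare, at \<open>t = 1\<close>, the coefficients of the arc leading from
  \<open>c\<close> to its successor \<open>c'\<close>. The left side vanishes, and by injectivity
  only \<open>c\<close> and \<open>c'\<close> contribute on the right as underpassages, with
  opposite signs; overpassages carry the factor \<open>1 - t\<close>.\<close>

lemma weights_constant_along_component:
  assumes x: "scale (1 - t_var) x = (\<Sum>c\<in>crossings D. scale (h c) (rho_gen D c))"
    and "c \<in> under_crossings D i" "c' \<in> under_crossings D i"
  shows "writhe D c * augmentation (h c) = writhe D c' * augmentation (h c')"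
proof (rule constant_along_component[OF link_D _ assms(2,3)])
  fix c c' assume c: "c \<in> under_crossings D i" "c' \<in> under_crossings D i"
    and eq: "out_arc D c = in_arc D c'"
  let ?m = "\<lambda>c. writhe D c * augmentation (h c)"
  define a where "a = in_arc D c'"
  have cc: "c \<in> crossings D" "c' \<in> crossings D" using c by (auto simp: under_crossings_def)
  have in_iff: "in_arc D d = a \<longleftrightarrow> d = c'" if "d \<in> crossings D" for d
    using inj_onD[OF inj_in_arc[OF link_D]] that cc(2) by (auto simp: a_def)
  have out_iff: "out_arc D d = a \<longleftrightarrow> d = c" if "d \<in> crossings D" for d
    using inj_onD[OF inj_out_arc[OF link_D]] that cc(1) by (auto simp: a_def eq[symmetric])
  have aug: "augmentation (f * Poly_Mapping.lookup (rho_gen D d) a) = augmentation f *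
      ((if right_arc D d = a then 1 else 0) - (if left_arc D d = a then 1 else 0))" for f d
    by (simp add: lookup_rho_gen algebra_simps augmentation_diff augmentation_add
        mult.commute[of f t_var] augmentation_t_mult)
  have "(1 - t_var) * Poly_Mapping.lookup x a
      = (\<Sum>d\<in>crossings D. h d * Poly_Mapping.lookup (rho_gen D d) a)"
    using arg_cong[OF x, of "\<lambda>f. Poly_Mapping.lookup f a"] by (simp add: lookup_sum)
  from arg_cong[OF this, of augmentation]
  have "(\<Sum>d\<in>crossings D. augmentation (h d * Poly_Mapping.lookup (rho_gen D d) a)) = 0"
    by (simp add: augmentation_sum left_diff_distrib augmentation_diff augmentation_t_mult)
  \<comment> \<open>Two separate indicators also cover the case \<open>c = c'\<close>, where the arc
    begins and ends at the same crossing.\<close>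
  also have "(\<Sum>d\<in>crossings D. augmentation (h d * Poly_Mapping.lookup (rho_gen D d) a))
      = (\<Sum>d\<in>crossings D. (if d = c' then ?m d else 0) - (if d = c then ?m d else 0))"
  proof (rule sum.cong)
    fix d assume "d \<in> crossings D"
    from in_iff[OF this] out_iff[OF this]
    show "augmentation (h d * Poly_Mapping.lookup (rho_gen D d) a)
      = (if d = c' then ?m d else 0) - (if d = c then ?m d else 0)"
      by (cases "right_to_left D d") (auto simp: aug right_arc_def left_arc_def writhe_def)
  qed simp
  also have "\<dots> = ?m c' - ?m c" using finite_crossings[OF link_D] cc by (simp add: sum_subtractf)
  finally show "?m c = ?m c'" by simp
qed

lemma annihilated_decomposition:
  assumes "scale (1 - t_var) x \<in> rho_image D"
  obtains m :: "nat \<Rightarrow> int"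
  where "x - (\<Sum>i\<in>{1..ncomp D}. scale (of_int (m i)) (longitude_rep i)) \<in> rho_image D"
proof -
  obtain h where h: "scale (1 - t_var) x = (\<Sum>c\<in>crossings D. scale (h c) (rho_gen D c))"
    using assms by (auto simp: rho_image_iff)
  \<comment> \<open>The common weight on component \<open>i\<close>. If the component never passes
    under, the value is arbitrary, but then \<open>longitude_rep i\<close> is an empty sum.\<close>
  define m where "m i = (let c = SOME c. c \<in> under_crossings D i in writhe D c * augmentation (h c))" for i
  have m: "augmentation (h c) = writhe D c * m i" if "c \<in> under_crossings D i" for c i
  proof -
    have "(SOME c. c \<in> under_crossings D i) \<in> under_crossings D i" using that by (rule someI)
    then have "writhe D c * augmentation (h c) = m i"
      using weights_constant_along_component[OF h that] by (simp add: m_def Let_def)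
    \<comment> \<open>The writhe is its own inverse.\<close>
    then have "writhe D c * (writhe D c * augmentation (h c)) = writhe D c * m i" by simp
    then show ?thesis by (simp add: writhe_def split: if_splits)
  qed
  have "\<exists>g. h c = of_int (augmentation (h c)) + (1 - t_var) * g" for c
    using one_minus_t_dvd_diff_augmentation[of "h c"] by (auto simp: dvd_def algebra_simps)
  then obtain g where g: "\<And>c. h c = of_int (augmentation (h c)) + (1 - t_var) * g c" by metis
  let ?y = "\<Sum>i\<in>{1..ncomp D}. scale (of_int (m i)) (longitude_rep i)"
  let ?z = "\<Sum>c\<in>crossings D. scale (g c) (rho_gen D c)"
  \<comment> \<open>Grouping the crossings by the component that passes under turns the integer
    parts of the coefficients into multiples of the longitudes.\<close>
  have "(\<Sum>c\<in>crossings D. scale (of_int (augmentation (h c))) (rho_gen D c))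
      = (\<Sum>i\<in>{1..ncomp D}. \<Sum>c\<in>under_crossings D i. scale (of_int (augmentation (h c))) (rho_gen D c))"
    unfolding under_crossings_eq[OF link_D]
    by (rule sum.group[symmetric]) (use finite_crossings[OF link_D] under_pt_coords(1)[OF link_D] in auto)
  also have "\<dots> = (\<Sum>i\<in>{1..ncomp D}. scale (of_int (m i)) (scale (1 - t_var) (longitude_rep i)))"
    by (rule sum.cong) (auto simp: scale_longitude_rep scale_sum_right scale_scale m mult.commute
        intro!: sum.cong)
  also have "\<dots> = scale (1 - t_var) ?y"
    by (simp add: scale_sum_right scale_scale mult.commute)
  finally have 1: "(\<Sum>c\<in>crossings D. scale (of_int (augmentation (h c))) (rho_gen D c)) = scale (1 - t_var) ?y" .
  have "scale (1 - t_var) x = (\<Sum>c\<in>crossings D. scale (of_int (augmentation (h c))) (rho_gen D c)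
      + scale (1 - t_var) (scale (g c) (rho_gen D c)))"
    unfolding h by (rule sum.cong) (simp, subst g, simp add: scale_add_left scale_scale)
  also have "\<dots> = scale (1 - t_var) (?y + ?z)"
    by (simp add: sum.distrib 1 scale_add_right scale_sum_right)
  finally have "x = ?y + ?z" by (rule scale_cancel[OF one_minus_t_nonzero])
  then have "x - ?y = ?z" by simp
  then show ?thesis using that[of m] rho_image_iff by metis
qed

end

section \<open>The two inclusions\<close>

theorem theorem9:
  fixes D :: diagram
  assumes "link_diagram D"
  shows "generated_submodule Laurent (red_alexander D) (longitude D ` {1..ncomp D})
    = {x \<in> carrier (red_alexander D). (1 - t_var) \<odot>\<^bsub>red_alexander D\<^esub> x = \<zero>\<^bsub>red_alexander D\<^esub>}"
    (is "?G = ?A")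
proof -
  interpret free_submodule "arcs D" "rho_image D" by (rule free_submodule_rho_image[OF assms])
  interpret M: module Laurent Q by (rule module_Q)
  have Q: "red_alexander D = Q" by (simp add: red_alexander_def)
  have longitude_cls: "longitude D i = cls (longitude_rep D i)" for i
    using longitude_eq[OF assms] by (simp add: quot_map_def cls_def)
  have kernel: "(1 - t_var) \<odot>\<^bsub>Q\<^esub> cls x = \<zero>\<^bsub>Q\<^esub> \<longleftrightarrow> scale (1 - t_var) x \<in> rho_image D" for x
    by (simp add: smult_Q zero_Q cls_eq_iff)
  have carrier_L: "r \<in> carrier Laurent" for r by (simp add: Laurent_def)
  show ?thesis
  proof
    have "submodule ?A Laurent Q" unfolding Q
    proof (rule M.submoduleI)
      fix a assume a: "a \<in> {x \<in> carrier Q. (1 - t_var) \<odot>\<^bsub>Q\<^esub> x = \<zero>\<^bsub>Q\<^esub>}"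
      then show "\<ominus>\<^bsub>Q\<^esub> a \<in> {x \<in> carrier Q. (1 - t_var) \<odot>\<^bsub>Q\<^esub> x = \<zero>\<^bsub>Q\<^esub>}"
        using M.smult_r_minus[OF carrier_L, of a "1 - t_var"] by simp
      fix r
      obtain u where "a = cls u" using a by (auto simp: carrier_Q)
      then have "(1 - t_var) \<odot>\<^bsub>Q\<^esub> (r \<odot>\<^bsub>Q\<^esub> a) = r \<odot>\<^bsub>Q\<^esub> ((1 - t_var) \<odot>\<^bsub>Q\<^esub> a)"
        by (simp add: smult_Q scale_scale mult.commute)
      then show "r \<odot>\<^bsub>Q\<^esub> a \<in> {x \<in> carrier Q. (1 - t_var) \<odot>\<^bsub>Q\<^esub> x = \<zero>\<^bsub>Q\<^esub>}"
        using a carrier_L by simp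
    qed (use carrier_L in \<open>auto simp: M.smult_r_distr\<close>)
    moreover have "longitude D ` {1..ncomp D} \<subseteq> ?A"
    proof
      fix y assume "y \<in> longitude D ` {1..ncomp D}"
      then obtain i where y: "y = cls (longitude_rep D i)" using longitude_cls by auto
      \<comment> \<open>The weights are extended by 0 to the crossings where component
        \<open>i\<close> does not pass under, which gives a combination over all crossings.\<close>
      have "scale (1 - t_var) (longitude_rep D i)
          = (\<Sum>c\<in>crossings D. scale (if c \<in> under_crossings D i then of_int (writhe D c) else 0) (rho_gen D c))"
        unfolding scale_longitude_rep[OF assms] using finite_crossings[OF assms]
        by (intro sum.mono_neutral_cong_left) (auto simp: under_crossings_def)
      then have "scale (1 - t_var) (longitude_rep D i) \<in> rho_image D"
        unfolding rho_image_iff[OF assms]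
        by (rule exI[of _ "\<lambda>c. if c \<in> under_crossings D i then of_int (writhe D c) else 0"])
      then show "y \<in> ?A" using keys_longitude_rep[OF assms] by (auto simp: Q y kernel carrier_Q)
    qed
    ultimately show "?G \<subseteq> ?A" unfolding generated_submodule_def Q by blast
  next
    show "?A \<subseteq> ?G" unfolding generated_submodule_def Q
    proof (intro subsetI InterI)
      fix x H
      assume x: "x \<in> {x \<in> carrier Q. (1 - t_var) \<odot>\<^bsub>Q\<^esub> x = \<zero>\<^bsub>Q\<^esub>}"
        and "H \<in> {H. submodule H Laurent Q \<and> longitude D ` {1..ncomp D} \<subseteq> H}"
      then have H: "submodule H Laurent Q" "longitude D ` {1..ncomp D} \<subseteq> H" by auto
      obtain v where v: "x = cls v" using x by (auto simp: carrier_Q)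
      then have "scale (1 - t_var) v \<in> rho_image D" using x kernel by simp
      then obtain m :: "nat \<Rightarrow> int" where
        "v - (\<Sum>i\<in>{1..ncomp D}. scale (of_int (m i)) (longitude_rep D i)) \<in> rho_image D"
        using annihilated_decomposition[OF assms] by blast
      then have x_eq: "x = cls (\<Sum>i\<in>{1..ncomp D}. scale (of_int (m i)) (longitude_rep D i))"
        by (simp add: v cls_eq_iff)
      \<comment> \<open>\<open>H\<close> is an arbitrary submodule containing the longitudes; its
        closure under sums and multiples is transferred to representatives one summand at a
        time.\<close>
      have "cls (\<Sum>i\<in>I. scale (of_int (m i)) (longitude_rep D i)) \<in> H" if "finite I" "I \<subseteq> {1..ncomp D}" for I
        using that
      proof (induction I rule: finite_induct)
        case empty
        show ?case using subgroup.one_closed[OF submodule.axioms(1)[OF H(1)]] by (simp add: zero_Q)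
      next
        case (insert i I)
        have "cls (longitude_rep D i) \<in> H" using insert.prems H(2) longitude_cls by auto
        then have "cls (scale (of_int (m i)) (longitude_rep D i)) \<in> H"
          using M.submoduleE(4)[OF H(1) carrier_L] by (metis smult_Q)
        then have "cls (scale (of_int (m i)) (longitude_rep D i))
            \<oplus>\<^bsub>Q\<^esub> cls (\<Sum>i\<in>I. scale (of_int (m i)) (longitude_rep D i)) \<in> H"
          using M.submoduleE(5)[OF H(1)] insert by auto
        then show ?case using insert.hyps by (simp add: add_Q)
      qed
      from this[of "{1..ncomp D}"] show "x \<in> H" by (simp add: x_eq)
    qed
  qed
qed

end
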